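(* Let $G,I,L,M,N,P,Q,R,S$ be any complex numbers and put $$\begin{aligned} A&=I+2L+2N+P+2Q+6R+4S-14,\\ E&=-I-2L-N-Q-3R-S+5,\\ F&=4G+I+2L+6N+5P+6Q+18R+16S-50,\\ H&=-L-2N-P-Q-4R-3S+10,\\ J&=-G-I-2L-M-2P-3Q-6R-7S+20,\\ K&=-2G-2M-2N-5P-2Q-6R-12S+30. \end{aligned}$$ Then for all integers $m\ge0$ and $n\ge1$, $$\begin{aligned} &\frac1{(A_1^{(n)})^5}\sum_{k_1+\cdots+k_5=m}\binom{m}{k_1,\dots,k_5}U_{k_1}^{(n)}\cdots U_{k_5}^{(n)}\\ &=\frac{A}{A_1^{(5n)}}5^mU_m^{(5n)}+\frac{E}{A_1^{(4n)}A_1^{(n)}}\sum_{k=0}^m\binom mk4^{m-k}U_{m-k}^{(4n)}U_k^{(n)}+F\left(\frac{-1}{563}\right)^n\sum_{k=0}^m\binom mkU_k^{(n)}\\ &\quad+\frac{G}{A_1^{(n)}}\sum_{k=0}^m\binom mkt_{2,k}^{(n)}U_{m-k}^{(n)}+\frac{H}{A_1^{(3n)}A_1^{(2n)}}\sum_{k=0}^m\binom mk3^{m-k}2^kU_{m-k}^{(3n)}U_k^{(2n)}\\ &\quad+\frac{I}{A_1^{(3n)}}\sum_{k=0}^m\binom mk3^kU_k^{(3n)}t_{1,m-k}^{(n)}\\ &\quad+\frac{J}{A_2^{(n)}A_1^{(2n)}}\sum_{k_1+k_2+k_3=m}\binom{m}{k_1,k_2,k_3}(-1)^{k_1}V_{k_1}^{(n)}2^{k_2}U_{k_2}^{(2n)}\\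 &\quad+\frac{K}{A_2^{(n)}}\sum_{k_1+k_2+k_3=m}\binom{m}{k_1,k_2,k_3}(-1)^{k_1}V_{k_1}^{(n)}t_{1,k_2}^{(n)}\\ &\quad+\frac{L}{A_1^{(3n)}(A_1^{(n)})^2}\sum_{k_1+k_2+k_3=m}\binom{m}{k_1,k_2,k_3}3^{k_1}U_{k_1}^{(3n)}U_{k_2}^{(n)}U_{k_3}^{(n)}\\ &\quad+\frac{M}{A_2^{(n)}(A_1^{(n)})^2}\sum_{k_1+k_2+k_3+k_4=m}\binom{m}{k_1,k_2,k_3,k_4}(-1)^{k_1}V_{k_1}^{(n)}U_{k_2}^{(n)}U_{k_3}^{(n)}\\ &\quad+\frac{N}{(A_1^{(2n)})^2A_1^{(n)}}\sum_{k_1+k_2+k_3=m}\binom{m}{k_1,k_2,k_3}2^{k_1}U_{k_1}^{(2n)}2^{k_2}U_{k_2}^{(2n)}U_{k_3}^{(n)}\\ &\quad+\frac{P}{A_1^{(n)}}\sum_{k_1+k_2+k_3=m}\binom{m}{k_1,k_2,k_3}t_{1,k_1}^{(n)}t_{1,k_2}^{(n)}U_{k_3}^{(n)}\\ &\quad+\frac{Q}{A_1^{(2n)}A_1^{(n)}}\sum_{k_1+k_2+k_3=m}\binom{m}{k_1,k_2,k_3}2^{k_1}U_{k_1}^{(2n)}t_{1,k_2}^{(n)}U_{k_3}^{(n)}\\ &\quad+\frac{R}{A_1^{(2n)}(A_1^{(n)})^3}\sum_{k_1+k_2+k_3+k_4=m}\binom{m}{k_1,k_2,k_3,k_4}2^{k_1}U_{k_1}^{(2n)}U_{k_2}^{(n)}U_{k_3}^{(n)}U_{k_4}^{(n)}\\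 &\quad+\frac{S}{(A_1^{(n)})^3}\sum_{k_1+k_2+k_3+k_4=m}\binom{m}{k_1,k_2,k_3,k_4}t_{1,k_1}^{(n)}U_{k_2}^{(n)}U_{k_3}^{(n)}U_{k_4}^{(n)}. \end{aligned}$$
   Context: Let $\lambda_1,\lambda_2,\lambda_3,\lambda_4$ be the (distinct, complex) roots of $x^4-x^3-x^2-x-1=0$ and $c_i=\frac1{-\lambda_i^3+6\lambda_i-1}$. A Tetranacci-type sequence is one in which, from index $4$ on, each term is the sum of the four preceding terms. For each $n\ge1$, let $A_1^{(n)}$ be the nonzero rational number and $U_k^{(n)}=T_{1,k}^{(s_{1,0}^{(n)},s_{1,1}^{(n)},s_{1,2}^{(n)},s_{1,3}^{(n)})}$ the Tetranacci-type sequence with integer initial values $U_j^{(n)}=s_{1,j}^{(n)}$ ($0\le j\le3$) of greatest common divisor $1$ such that $$\sum_{i=1}^4c_i^ne^{\lambda_ix}=\frac1{A_1^{(n)}}\sum_{k=0}^\infty U_k^{(n)}\frac{x^k}{k!}.$$ Likewise let $A_2^{(n)}$ be the nonzero rational number and $V_k^{(n)}=T_{2,k}^{(s_{2,0}^{(n)},s_{2,1}^{(n)},s_{2,2}^{(n)},s_{2,3}^{(n)})}$ the Tetranacci-type sequence with integer initial values $V_j^{(n)}=s_{2,j}^{(n)}$ ($0\le j\le3$) of greatest common divisor $1$ such that $$\sum_{i=1}^4\Big(\prod_{j\ne i}c_j^n\Big)e^{\lambda_ix}=\frac1{A_2^{(n)}}\sum_{k=0}^\infty V_k^{(n)}\frac{x^k}{k!}.$$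 The signs are fixed by requiring $U_k^{(n)}>0$ and $V_k^{(n)}>0$ for all sufficiently large $k$. Put $$t_{1,m}^{(n)}=\frac12\left(\frac1{(A_1^{(n)})^2}\sum_{k=0}^m\binom mkU_k^{(n)}U_{m-k}^{(n)}-\frac{2^m}{A_1^{(2n)}}U_m^{(2n)}\right),$$ equivalently $\sum_{m\ge0}t_{1,m}^{(n)}\frac{x^m}{m!}=\sum_{1\le i<j\le4}c_i^nc_j^ne^{(\lambda_i+\lambda_j)x}$, and define $t_{2,m}^{(n)}$ by $$\sum_{m=0}^\infty t_{2,m}^{(n)}\frac{x^m}{m!}=\sum_{1\le i<j<l\le4}c_i^nc_j^nc_l^ne^{(\lambda_i+\lambda_j+\lambda_l)x}\left(c_i^ne^{\lambda_ix}+c_j^ne^{\lambda_jx}+c_l^ne^{\lambda_lx}\right).$$ Superscripts $(n)$ are indices; $c_i^n$ is an $n$-th power. All indices $k_i$ run over nonnegative integers and $\binom{m}{k_1,\dots,k_r}=\frac{m!}{k_1!\cdots k_r!}$.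
   Formalization: The F-term is proved with an additional factor 1/A_1^{(n)}, i.e. (F/A_1^{(n)})(-1/563)^n times the sum; without it the formula fails, e.g. for n=2, m=0 and G=I=L=M=N=P=Q=R=S=0, where A_1^{(2)}=563. *)

theory Defs
  imports Complex_Main "HOL-Computational_Algebra.Formal_Power_Series"
begin

definition enumerates_tetra_roots :: "(nat \<Rightarrow> complex) \<Rightarrow> bool" where
  "enumerates_tetra_roots lam \<longleftrightarrow>
     bij_betw lam {1..4} {x. x ^ 4 - x ^ 3 - x ^ 2 - x - 1 = 0}"

definition tetra_coeff :: "complex \<Rightarrow> complex" where
  "tetra_coeff x = 1 / (- (x ^ 3) + 6 * x - 1)"

definition tetranacci_type :: "(nat \<Rightarrow> int) \<Rightarrow> bool" where
  "tetranacci_type u \<longleftrightarrow> (\<forall>k\<ge>4. u k = u (k - 1) + u (k - 2) + u (k - 3) + u (k - 4))"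

definition egf :: "(nat \<Rightarrow> complex) \<Rightarrow> complex fps" where
  "egf a = Abs_fps (\<lambda>k. a k / fact k)"

text \<open>
  The next predicate says that \<open>f(x) = (1/A) \<Sum>\<^sub>k u\<^sub>k x\<^sup>k/k!\<close>, normalised in the way that
  determines \<open>A\<close> and \<open>u\<close>: coprime integer initial values fix them up to a common sign, and
  eventual positivity fixes the sign.
\<close>

definition normalised_tetranacci_expansion :: "complex fps \<Rightarrow> rat \<Rightarrow> (nat \<Rightarrow> int) \<Rightarrow> bool" where
  "normalised_tetranacci_expansion f A u \<longleftrightarrow>
     A \<noteq> 0 \<and> tetranacci_type u \<and> Gcd (u ` {0..3}) = 1 \<and>
     (\<forall>\<^sub>F k in sequentially. u k > 0) \<and>
     f = fps_const (1 / of_rat A) * egf (\<lambda>k. of_int (u k))"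

definition tetra_gf1 :: "(nat \<Rightarrow> complex) \<Rightarrow> nat \<Rightarrow> complex fps" where
  "tetra_gf1 lam n =
     (\<Sum>i=1..4. fps_const (tetra_coeff (lam i) ^ n) * fps_exp (lam i))"

definition tetra_gf2 :: "(nat \<Rightarrow> complex) \<Rightarrow> nat \<Rightarrow> complex fps" where
  "tetra_gf2 lam n =
     (\<Sum>i=1..4. fps_const (\<Prod>j\<in>{1..4}-{i}. tetra_coeff (lam j) ^ n) * fps_exp (lam i))"

definition tetra_t1 :: "(nat \<Rightarrow> rat) \<Rightarrow> (nat \<Rightarrow> nat \<Rightarrow> int) \<Rightarrow> nat \<Rightarrow> nat \<Rightarrow> complex" where
  "tetra_t1 A1 U n m =
     1 / 2 * (1 / of_rat (A1 n) ^ 2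
                * (\<Sum>k=0..m. of_nat (m choose k) * of_int (U n k) * of_int (U n (m - k)))
              - 2 ^ m / of_rat (A1 (2 * n)) * of_int (U (2 * n) m))"

text \<open>The factor \<open>fact m\<close> below turns the coefficient of \<open>x\<^sup>m\<close> into that of \<open>x\<^sup>m/m!\<close>.\<close>

definition tetra_t2 :: "(nat \<Rightarrow> complex) \<Rightarrow> nat \<Rightarrow> nat \<Rightarrow> complex" where
  "tetra_t2 lam n m = fact m * fps_nth
     (\<Sum>(i, j, l)\<in>{(i, j, l). 1 \<le> i \<and> i < j \<and> j < l \<and> l \<le> 4}.
        fps_const (tetra_coeff (lam i) ^ n * tetra_coeff (lam j) ^ n * tetra_coeff (lam l) ^ n)
        * fps_exp (lam i + lam j + lam l)
        * (fps_const (tetra_coeff (lam i) ^ n) * fps_exp (lam i)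
           + fps_const (tetra_coeff (lam j) ^ n) * fps_exp (lam j)
           + fps_const (tetra_coeff (lam l) ^ n) * fps_exp (lam l))) m"

definition multinom :: "nat list \<Rightarrow> complex" where
  "multinom ks = fact (sum_list ks) / (\<Prod>k\<leftarrow>ks. fact k)"

end

theory Submission
  imports Defs
begin

text \<open>
  Let \<open>w\<^sub>i = c\<^sub>i^n e^(\<lambda>\<^sub>i x)\<close> for \<open>i = 1, \<dots>, 4\<close>. Every sum in the theorem is, up to the constants
  \<open>1/A\<^sub>1\<close> and \<open>1/A\<^sub>2\<close>, the coefficient of \<open>x^m/m!\<close> in a product of symmetric polynomials of
  the \<open>w\<^sub>i\<close>. A factor \<open>j^k U\<^sub>k\<close> with superscript \<open>(j n)\<close> comes from the power sum
  \<open>p\<^sub>j = \<Sum> w\<^sub>i^j\<close>, since raising \<open>w\<^sub>i\<close> to the power \<open>j\<close> replaces \<open>n\<close> by \<open>j n\<close> and \<open>x\<close> by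
  \<open>j x\<close> (lemma \<open>egf_U\<close>). The sequence \<open>t\<^sub>1\<close> belongs to the elementary symmetric polynomial
  \<open>e\<^sub>2 = (p\<^sub>1^2 - p\<^sub>2) / 2\<close>, and \<open>t\<^sub>2\<close> belongs to \<open>e\<^sub>1 e\<^sub>3 - 4 e\<^sub>4\<close>.

  The polynomials \<open>e\<^sub>3\<close> and \<open>e\<^sub>4\<close> are accessible because the roots have sum \<open>1\<close>. The product of
  all \<open>w\<^sub>j\<close> with \<open>j \<noteq> i\<close> has the exponential \<open>e^((1 - \<lambda>\<^sub>i) x)\<close>, so \<open>e\<^sub>3\<close> is \<open>e^x\<close> times the
  generating function of the \<open>V\<^sub>k\<close> evaluated at \<open>-x\<close> (lemma \<open>egf_V\<close>). Likewise
  \<open>e\<^sub>4 = (-1/563)^n e^x\<close>, where \<open>-563\<close> is the product of the values \<open>-\<lambda>\<^sub>i^3 + 6 \<lambda>\<^sub>i - 1\<close> (lemma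
  \<open>prod_tetra_coeff\<close>). The factor \<open>e^x\<close> explains why the terms with coefficients \<open>F\<close>, \<open>J\<close>, \<open>K\<close>, \<open>M\<close> have
  a summation index on which no sequence depends: it belongs to the constant sequence \<open>1\<close>.

  What remains is the identity \<open>power5_sum_identity\<close>, which writes \<open>e\<^sub>1^5\<close> as a combination of
  products of degree five in four variables. These products are linearly dependent, and this
  leaves the nine parameters \<open>G, I, L, M, N, P, Q, R, S\<close> free.
\<close>

section \<open>Convolution of exponential generating functions\<close>

lemma finite_Collect_add_eq:
  fixes s :: "'b \<Rightarrow> nat"
  assumes "\<And>r. finite {y. s y = r}"
  shows "finite {(k, y). k + s y = m}"
proof -
  have "{(k, y). k + s y = m} = (SIGMA k:{0..m}. {y. s y = m - k})"
    by auto
  then show ?thesis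
    using assms by simp
qed

lemma finite_Collect_add2_eq: "finite {(k1, k2). k1 + k2 = (m::nat)}"
  using finite_Collect_add_eq[of "\<lambda>k. k" m] by simp

lemma finite_Collect_add3_eq: "finite {(k1, k2, k3). k1 + k2 + k3 = (m::nat)}"
  using finite_Collect_add_eq[of "\<lambda>(k2, k3). k2 + k3" m] finite_Collect_add2_eq
  by (simp add: case_prod_unfold add.assoc)

lemma finite_Collect_add4_eq: "finite {(k1, k2, k3, k4). k1 + k2 + k3 + k4 = (m::nat)}"
  using finite_Collect_add_eq[of "\<lambda>(k2, k3, k4). k2 + k3 + k4" m] finite_Collect_add3_eq
  by (simp add: case_prod_unfold add.assoc)

text \<open>The tuples of indices with sum \<open>m\<close> are nested pairs. This lemma adds one index: \<open>y\<close> stands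
  for the remaining tuple, \<open>s y\<close> for the sum of its entries, and \<open>h y\<close> for the product of the
  coefficients taken from the other factors.\<close>

lemma fps_nth_mult_indexed_sum:
  fixes f g :: "'a::semiring_0 fps" and s :: "'b \<Rightarrow> nat"
  assumes "\<And>r. finite {y. s y = r}" and "\<And>r. fps_nth g r = (\<Sum>y\<in>{y. s y = r}. h y)"
  shows "fps_nth (f * g) m = (\<Sum>(k, y)\<in>{(k, y). k + s y = m}. fps_nth f k * h y)"
proof -
  have eq: "{(k, y). k + s y = m} = (SIGMA k:{0..m}. {y. s y = m - k})"
    by auto
  show ?thesis
    unfolding eq fps_mult_nth using assms
    by (simp add: sum.Sigma[symmetric] sum_distrib_left)
qed

lemma fps_nth_mult2:
  fixes f g :: "'a::semiring_0 fps"
  shows "fps_nth (f * g) m = (\<Sum>(k1, k2)\<in>{(k1, k2). k1 + k2 = m}. fps_nth f k1 * fps_nth g k2)"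
  using fps_nth_mult_indexed_sum[of "\<lambda>k. k" g "fps_nth g" f m] by simp

lemma fps_nth_mult3:
  fixes f g h :: "'a::semiring_0 fps"
  shows "fps_nth (f * (g * h)) m =
      (\<Sum>(k1, k2, k3)\<in>{(k1, k2, k3). k1 + k2 + k3 = m}. fps_nth f k1 * (fps_nth g k2 * fps_nth h k3))"
  using fps_nth_mult_indexed_sum[of "\<lambda>(k2, k3). k2 + k3" "g * h"
      "\<lambda>(k2, k3). fps_nth g k2 * fps_nth h k3" f m]
    finite_Collect_add2_eq fps_nth_mult2[of g h]
  by (simp add: case_prod_unfold add.assoc)

lemma fps_nth_mult4:
  fixes f g h p :: "'a::semiring_0 fps"
  shows "fps_nth (f * (g * (h * p))) m =
      (\<Sum>(k1, k2, k3, k4)\<in>{(k1, k2, k3, k4). k1 + k2 + k3 + k4 = m}.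
         fps_nth f k1 * (fps_nth g k2 * (fps_nth h k3 * fps_nth p k4)))"
  using fps_nth_mult_indexed_sum[of "\<lambda>(k2, k3, k4). k2 + k3 + k4" "g * (h * p)"
      "\<lambda>(k2, k3, k4). fps_nth g k2 * (fps_nth h k3 * fps_nth p k4)" f m]
    finite_Collect_add3_eq fps_nth_mult3[of g h p]
  by (simp add: case_prod_unfold add.assoc)

lemma fps_nth_mult5:
  fixes f g h p q :: "'a::semiring_0 fps"
  shows "fps_nth (f * (g * (h * (p * q)))) m =
      (\<Sum>(k1, k2, k3, k4, k5)\<in>{(k1, k2, k3, k4, k5). k1 + k2 + k3 + k4 + k5 = m}.
         fps_nth f k1 * (fps_nth g k2 * (fps_nth h k3 * (fps_nth p k4 * fps_nth q k5))))"
  using fps_nth_mult_indexed_sum[of "\<lambda>(k2, k3, k4, k5). k2 + k3 + k4 + k5" "g * (h * (p * q))"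
      "\<lambda>(k2, k3, k4, k5). fps_nth g k2 * (fps_nth h k3 * (fps_nth p k4 * fps_nth q k5))" f m]
    finite_Collect_add4_eq fps_nth_mult4[of g h p q]
  by (simp add: case_prod_unfold add.assoc)

lemma egf_nth: "fps_nth (egf a) k = a k / fact k"
  by (simp add: egf_def)

lemma egf_fact_mult_nth: "egf (\<lambda>k. fact k * fps_nth f k) = f"
  by (rule fps_ext) (simp add: egf_nth)

lemma egf_one: "egf (\<lambda>_. 1) = fps_exp 1"
  by (rule fps_ext) (simp add: egf_nth)

text \<open>In the convolution lemmas each generating function is given as a scalar multiple of another
  series, so that the normalising constants of the sequences can be pulled out of the sum.\<close>

lemma binomial_convolution:
  assumes "egf a = fps_const x * f" and "egf b = fps_const y * g"
  shows "(\<Sum>k=0..m. of_nat (m choose k) * (a k * b (m - k))) = fact m * (x * y * fps_nth (f * g) m)"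
proof -
  have "(\<Sum>k=0..m. of_nat (m choose k) * (a k * b (m - k))) = fact m * fps_nth (egf a * egf b) m"
    by (simp add: fps_mult_nth egf_nth sum_distrib_left binomial_fact field_simps)
  also have "egf a * egf b = fps_const (x * y) * (f * g)"
    by (simp add: assms mult_ac flip: fps_const_mult)
  finally show ?thesis
    by simp
qed

lemma multinomial_convolution3:
  assumes "egf a = fps_const x * f" and "egf b = fps_const y * g" and "egf c = fps_const z * h"
  shows "(\<Sum>(k1, k2, k3)\<in>{(k1, k2, k3). k1 + k2 + k3 = m}.
      multinom [k1, k2, k3] * (a k1 * (b k2 * c k3)))
    = fact m * (x * y * z * fps_nth (f * (g * h)) m)"
proof -
  have "(\<Sum>(k1, k2, k3)\<in>{(k1, k2, k3). k1 + k2 + k3 = m}.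
      multinom [k1, k2, k3] * (a k1 * (b k2 * c k3)))
      = fact m * fps_nth (egf a * (egf b * egf c)) m"
    unfolding fps_nth_mult3 sum_distrib_left
    by (rule sum.cong) (auto simp: multinom_def egf_nth field_simps)
  also have "egf a * (egf b * egf c) = fps_const (x * y * z) * (f * (g * h))"
    by (simp add: assms mult_ac flip: fps_const_mult)
  finally show ?thesis
    by simp
qed

lemma multinomial_convolution4:
  assumes "egf a = fps_const x * f" and "egf b = fps_const y * g" and "egf c = fps_const z * h"
    and "egf d = fps_const u * p"
  shows "(\<Sum>(k1, k2, k3, k4)\<in>{(k1, k2, k3, k4). k1 + k2 + k3 + k4 = m}.
      multinom [k1, k2, k3, k4] * (a k1 * (b k2 * (c k3 * d k4))))
    = fact m * (x * y * z * u * fps_nth (f * (g * (h * p))) m)"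
proof -
  have "(\<Sum>(k1, k2, k3, k4)\<in>{(k1, k2, k3, k4). k1 + k2 + k3 + k4 = m}.
      multinom [k1, k2, k3, k4] * (a k1 * (b k2 * (c k3 * d k4))))
      = fact m * fps_nth (egf a * (egf b * (egf c * egf d))) m"
    unfolding fps_nth_mult4 sum_distrib_left
    by (rule sum.cong) (auto simp: multinom_def egf_nth field_simps)
  also have "egf a * (egf b * (egf c * egf d)) = fps_const (x * y * z * u) * (f * (g * (h * p)))"
    by (simp add: assms mult_ac flip: fps_const_mult)
  finally show ?thesis
    by simp
qed

lemma multinomial_convolution5:
  assumes "egf a = fps_const x * f" and "egf b = fps_const y * g" and "egf c = fps_const z * h"
    and "egf d = fps_const u * p" and "egf e = fps_const v * q"
  shows "(\<Sum>(k1, k2, k3, k4, k5)\<in>{(k1, k2, k3, k4, k5). k1 + k2 + k3 + k4 + k5 = m}.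
      multinom [k1, k2, k3, k4, k5] * (a k1 * (b k2 * (c k3 * (d k4 * e k5)))))
    = fact m * (x * y * z * u * v * fps_nth (f * (g * (h * (p * q)))) m)"
proof -
  have "(\<Sum>(k1, k2, k3, k4, k5)\<in>{(k1, k2, k3, k4, k5). k1 + k2 + k3 + k4 + k5 = m}.
      multinom [k1, k2, k3, k4, k5] * (a k1 * (b k2 * (c k3 * (d k4 * e k5)))))
      = fact m * fps_nth (egf a * (egf b * (egf c * (egf d * egf e)))) m"
    unfolding fps_nth_mult5 sum_distrib_left
    by (rule sum.cong) (auto simp: multinom_def egf_nth field_simps)
  also have "egf a * (egf b * (egf c * (egf d * egf e))) = fps_const (x * y * z * u * v) * (f * (g * (h * (p * q))))"
    by (simp add: assms mult_ac flip: fps_const_mult)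
  finally show ?thesis
    by simp
qed

text \<open>Replacing \<open>x\<close> by \<open>z x\<close> in an exponential sum multiplies the \<open>k\<close>-th term of its
  sequence by \<open>z ^ k\<close>. This is the source of the factors \<open>2 ^ k\<close>, \<open>3 ^ k\<close>, \<open>4 ^ k\<close>, \<open>5 ^ k\<close>
  and \<open>(-1) ^ k\<close> in the theorem.\<close>

lemma egf_scaled_exponential_sum:
  assumes "(\<Sum>i\<in>X. fps_const (a i) * fps_exp (x i)) = fps_const (1 / B) * egf u" and "B \<noteq> 0"
  shows "egf (\<lambda>k. z ^ k * u k) = fps_const B * (\<Sum>i\<in>X. fps_const (a i) * fps_exp (z * x i))"
proof (rule fps_ext)
  fix k
  have "fps_nth (\<Sum>i\<in>X. fps_const (a i) * fps_exp (x i)) k = u k / fact k / B"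
    unfolding assms(1) by (simp add: egf_nth)
  then have "(\<Sum>i\<in>X. a i * x i ^ k / fact k) = u k / fact k / B"
    by (simp add: fps_sum_nth)
  then have "u k / fact k = B * (\<Sum>i\<in>X. a i * x i ^ k / fact k)"
    using assms(2) by simp
  then have "z ^ k * (u k / fact k) = B * (\<Sum>i\<in>X. z ^ k * (a i * x i ^ k / fact k))"
    by (simp add: sum_distrib_left mult.left_commute)
  then show "fps_nth (egf (\<lambda>k. z ^ k * u k)) k =
      fps_nth (fps_const B * (\<Sum>i\<in>X. fps_const (a i) * fps_exp (z * x i))) k"
    by (simp add: egf_nth fps_sum_nth power_mult_distrib mult_ac)
qed

section \<open>The roots\<close>

text \<open>Subtracting the equations of two roots and cancelling the nonzero difference of the roots
  gives the divided differences of the quartic. After three rounds only the sum of the roots is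
  left, and the other coefficients follow by substituting back.\<close>

lemma vieta_four_distinct:
  fixes a b c d p q r s :: "'a::idom"
  assumes "a \<noteq> b" "a \<noteq> c" "a \<noteq> d" "b \<noteq> c" "b \<noteq> d" "c \<noteq> d"
    and root: "\<And>x. x \<in> {a, b, c, d} \<Longrightarrow> x ^ 4 - p * x ^ 3 + q * x ^ 2 - r * x + s = 0"
  shows "a + b + c + d = p" and "a * b + a * c + a * d + b * c + b * d + c * d = q"
    and "a * b * c + a * b * d + a * c * d + b * c * d = r" and "a * b * c * d = s"
proof -
  let ?D2 = "\<lambda>x y. x^3 + x^2*y + x*y^2 + y^3 - p * (x^2 + x*y + y^2) + q * (x + y) - r"
  let ?D3 = "\<lambda>x y z. x^2 + y^2 + z^2 + x*y + x*z + y*z - p * (x + y + z) + q"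
  have fa: "a ^ 4 - p * a ^ 3 + q * a ^ 2 - r * a + s = 0"
   and fb: "b ^ 4 - p * b ^ 3 + q * b ^ 2 - r * b + s = 0"
   and fc: "c ^ 4 - p * c ^ 3 + q * c ^ 2 - r * c + s = 0"
   and fd: "d ^ 4 - p * d ^ 3 + q * d ^ 2 - r * d + s = 0"
    using root by blast+
  have "(a - b) * ?D2 a b = 0" using fa fb by algebra
  then have ab: "?D2 a b = 0" using assms by simp
  have "(a - c) * ?D2 a c = 0" using fa fc by algebra
  then have ac: "?D2 a c = 0" using assms by simp
  have "(a - d) * ?D2 a d = 0" using fa fd by algebra
  then have ad: "?D2 a d = 0" using assms by simp
  have "(b - c) * ?D3 a b c = 0" using ab ac by algebra
  then have abc: "?D3 a b c = 0" using assms by simp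
  have "(b - d) * ?D3 a b d = 0" using ab ad by algebra
  then have abd: "?D3 a b d = 0" using assms by simp
  have "(c - d) * (a + b + c + d - p) = 0" using abc abd by algebra
  then show p: "a + b + c + d = p" using assms by simp
  show q: "a * b + a * c + a * d + b * c + b * d + c * d = q" using abc p by algebra
  show r: "a * b * c + a * b * d + a * c * d + b * c * d = r" using ab p q by algebra
  show "a * b * c * d = s" using fa p q r by algebra
qed

lemma tetra_roots_vieta:
  assumes "enumerates_tetra_roots lam"
  shows "lam 1 + lam 2 + lam 3 + lam 4 = 1"
    and "lam 1 * lam 2 + lam 1 * lam 3 + lam 1 * lam 4 + lam 2 * lam 3 + lam 2 * lam 4
       + lam 3 * lam 4 = -1"
    and "lam 1 * lam 2 * lam 3 + lam 1 * lam 2 * lam 4 + lam 1 * lam 3 * lam 4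
       + lam 2 * lam 3 * lam 4 = 1"
    and "lam 1 * lam 2 * lam 3 * lam 4 = -1"
proof -
  have bij: "bij_betw lam {1..4} {x. x ^ 4 - x ^ 3 - x ^ 2 - x - 1 = 0}"
    using assms by (simp add: enumerates_tetra_roots_def)
  have distinct: "lam i \<noteq> lam j" if "i \<in> {1..4}" "j \<in> {1..4}" "i \<noteq> j" for i j
    using bij that by (auto simp: bij_betw_def inj_on_def)
  have root: "lam i ^ 4 - lam i ^ 3 - lam i ^ 2 - lam i - 1 = 0" if "i \<in> {1..4}" for i
    using bij that by (auto simp: bij_betw_def)
  have "x ^ 4 - 1 * x ^ 3 + (-1) * x ^ 2 - 1 * x + (-1) = 0"
    if "x \<in> {lam 1, lam 2, lam 3, lam 4}" for x
    using that root[of 1] root[of 2] root[of 3] root[of 4] by auto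
  moreover have "lam 1 \<noteq> lam 2" "lam 1 \<noteq> lam 3" "lam 1 \<noteq> lam 4" "lam 2 \<noteq> lam 3" "lam 2 \<noteq> lam 4"
    "lam 3 \<noteq> lam 4"
    using distinct by simp_all
  ultimately have v: "lam 1 + lam 2 + lam 3 + lam 4 = 1 \<and>
      lam 1 * lam 2 + lam 1 * lam 3 + lam 1 * lam 4 + lam 2 * lam 3 + lam 2 * lam 4 + lam 3 * lam 4 = -1 \<and>
      lam 1 * lam 2 * lam 3 + lam 1 * lam 2 * lam 4 + lam 1 * lam 3 * lam 4 + lam 2 * lam 3 * lam 4 = 1 \<and>
      lam 1 * lam 2 * lam 3 * lam 4 = -1"
    by (intro conjI vieta_four_distinct)
  show "lam 1 + lam 2 + lam 3 + lam 4 = 1"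
    "lam 1 * lam 2 + lam 1 * lam 3 + lam 1 * lam 4 + lam 2 * lam 3 + lam 2 * lam 4
       + lam 3 * lam 4 = -1"
    "lam 1 * lam 2 * lam 3 + lam 1 * lam 2 * lam 4 + lam 1 * lam 3 * lam 4
       + lam 2 * lam 3 * lam 4 = 1"
    "lam 1 * lam 2 * lam 3 * lam 4 = -1"
    using v by blast+
qed

text \<open>The denominators \<open>-x^3 + 6 x - 1\<close>, taken at the four roots of the quartic, multiply to a
  resultant. Grouping the roots into two pairs with sums \<open>s\<close>, \<open>s'\<close> and products \<open>p\<close>, \<open>p'\<close> keeps the elimination small: each pair
  contributes a polynomial in its sum and product.\<close>

lemma prod_tetra_coeff:
  assumes "enumerates_tetra_roots lam"
  shows "tetra_coeff (lam 1) * tetra_coeff (lam 2) * tetra_coeff (lam 3) * tetra_coeff (lam 4)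
     = - 1 / 563"
proof -
  define q where "q x = - (x ^ 3) + 6 * x - 1" for x :: complex
  \<comment> \<open>\<open>t (x + y) (x y)\<close> is the expansion of \<open>q x * q y\<close>.\<close>
  define t where "t s p = p^3 - 6 * p * (s^2 - 2 * p) + (s^3 - 3 * s * p) + 36 * p - 6 * s + 1"
    for s p :: complex
  have pair: "q x * q y = t (x + y) (x * y)" for x y
    unfolding q_def t_def by algebra
  define s p s' p' where "s = lam 1 + lam 2" and "p = lam 1 * lam 2"
    and "s' = lam 3 + lam 4" and "p' = lam 3 * lam 4"
  note v = tetra_roots_vieta[OF assms]
  have e1: "s + s' = 1" using v(1) by (simp add: s_def s'_def add.assoc)
  have e2: "p + p' + s * s' = -1" using v(2) by (simp add: s_def s'_def p_def p'_def algebra_simps)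
  have e3: "p * s' + p' * s = 1" using v(3) by (simp add: s_def s'_def p_def p'_def algebra_simps)
  have e4: "p * p' = -1" using v(4) by (simp add: p_def p'_def algebra_simps)
  have "t s p * t s' p' = -563"
    unfolding t_def using e1 e2 e3 e4 by algebra
  then have "q (lam 1) * q (lam 2) * (q (lam 3) * q (lam 4)) = -563"
    unfolding pair s_def p_def s'_def p'_def .
  then have prod: "q (lam 1) * q (lam 2) * q (lam 3) * q (lam 4) = -563"
    by (simp add: mult.assoc)
  have "tetra_coeff (lam 1) * tetra_coeff (lam 2) * tetra_coeff (lam 3) * tetra_coeff (lam 4)
      = 1 / (q (lam 1) * q (lam 2) * q (lam 3) * q (lam 4))"
    by (simp add: tetra_coeff_def q_def)
  then show ?thesis unfolding prod by simp
qed

section \<open>The symmetric-function identity\<close>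

text \<open>Newton's formulas turn both sides into polynomials in \<open>e1\<close>, \<open>e2\<close>, \<open>e3\<close>, \<open>e4\<close>. Each free
  parameter then has coefficient \<open>0\<close> in the difference of the two sides; for example, \<open>M\<close> is multiplied by
  \<open>e3 (e1^2 - p2 - 2 e2)\<close>. With all parameters equal to \<open>0\<close> the claim is
  \<open>e1^5 = -14 p5 + 5 p4 e1 - 50 e4 e1 + 10 p3 p2 + 20 e3 p2 + 30 e3 e2\<close>.\<close>

lemma power5_sum_identity:
  fixes a b c d G I L M N P Q R S :: "'a::comm_ring_1"
  assumes e1: "e1 = a + b + c + d" and e2: "e2 = a*b + a*c + a*d + b*c + b*d + c*d"
    and e3: "e3 = a*b*c + a*b*d + a*c*d + b*c*d" and e4: "e4 = a*b*c*d"
    and p2: "p2 = a^2 + b^2 + c^2 + d^2" and p3: "p3 = a^3 + b^3 + c^3 + d^3"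
    and p4: "p4 = a^4 + b^4 + c^4 + d^4" and p5: "p5 = a^5 + b^5 + c^5 + d^5"
    and t2: "t2 = a*b*c * (a + b + c) + a*b*d * (a + b + d) + a*c*d * (a + c + d)
      + b*c*d * (b + c + d)"
    and A: "A = I + 2 * L + 2 * N + P + 2 * Q + 6 * R + 4 * S - 14"
    and E: "E = - I - 2 * L - N - Q - 3 * R - S + 5"
    and F: "F = 4 * G + I + 2 * L + 6 * N + 5 * P + 6 * Q + 18 * R + 16 * S - 50"
    and H: "H = - L - 2 * N - P - Q - 4 * R - 3 * S + 10"
    and J: "J = - G - I - 2 * L - M - 2 * P - 3 * Q - 6 * R - 7 * S + 20"
    and K: "K = - 2 * G - 2 * M - 2 * N - 5 * P - 2 * Q - 6 * R - 12 * S + 30"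
  shows "e1 ^ 5 = A * p5 + E * (p4 * e1) + F * (e4 * e1) + G * (t2 * e1) + H * (p3 * p2)
    + I * (p3 * e2) + J * (e3 * p2) + K * (e3 * e2) + L * (p3 * (e1 * e1)) + M * (e3 * (e1 * e1))
    + N * (p2 * (p2 * e1)) + P * (e2 * (e2 * e1)) + Q * (p2 * (e2 * e1))
    + R * (p2 * (e1 * (e1 * e1))) + S * (e2 * (e1 * (e1 * e1)))"
proof -
  have p2': "p2 = e1^2 - 2*e2"
    unfolding p2 e1 e2
    by (simp add: algebra_simps power2_eq_square power3_eq_cube power_numeral_reduce)
  have p3': "p3 = e1^3 - 3*e1*e2 + 3*e3"
    unfolding p3 e1 e2 e3
    by (simp add: algebra_simps power2_eq_square power3_eq_cube power_numeral_reduce)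
  have p4': "p4 = e1^4 - 4*e1^2*e2 + 2*e2^2 + 4*e1*e3 - 4*e4"
    unfolding p4 e1 e2 e3 e4
    by (simp add: algebra_simps power2_eq_square power3_eq_cube power_numeral_reduce)
  have p5': "p5 = e1^5 - 5*e1^3*e2 + 5*e1*e2^2 + 5*e1^2*e3 - 5*e2*e3 - 5*e1*e4"
    unfolding p5 e1 e2 e3 e4
    by (simp add: algebra_simps power2_eq_square power3_eq_cube power_numeral_reduce)
  have t2': "t2 = e1*e3 - 4*e4"
    unfolding t2 e1 e3 e4
    by (simp add: algebra_simps power2_eq_square power3_eq_cube power_numeral_reduce)
  show ?thesis
    unfolding p2' p3' p4' p5' t2' A E F H J K
    by (simp add: algebra_simps power2_eq_square power3_eq_cube power_numeral_reduce)
qed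

section \<open>Translation of the sequences\<close>

text \<open>The summand \<open>c\<^sub>i^n e^(\<lambda>\<^sub>i x)\<close>, treated as one variable of the symmetric polynomials.\<close>

definition tetra_wave :: "(nat \<Rightarrow> complex) \<Rightarrow> nat \<Rightarrow> nat \<Rightarrow> complex fps" where
  "tetra_wave lam n i = fps_const (tetra_coeff (lam i) ^ n) * fps_exp (lam i)"

lemma sum_1_to_4: "(\<Sum>i=1..4. f i) = f 1 + f 2 + f 3 + f (4::nat)"
  by (simp add: numeral_eq_Suc)

lemma tetra_wave_power:
  "tetra_wave lam n i ^ j = fps_const (tetra_coeff (lam i) ^ (j * n)) * fps_exp (of_nat j * lam i)"
  by (simp add: tetra_wave_def power_mult_distrib fps_const_power fps_exp_power_mult
      power_mult[symmetric] mult.commute)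

lemma egf_U:
  assumes "normalised_tetranacci_expansion (tetra_gf1 lam (j * n)) B u"
  defines "w \<equiv> tetra_wave lam n"
  shows "egf (\<lambda>k. of_nat j ^ k * of_int (u k))
     = fps_const (of_rat B) * (w 1 ^ j + w 2 ^ j + w 3 ^ j + w 4 ^ j)"
proof -
  have "egf (\<lambda>k. of_nat j ^ k * of_int (u k)) = fps_const (of_rat B) * (\<Sum>i=1..4. w i ^ j)"
    unfolding w_def tetra_wave_power using assms(1)
    by (intro egf_scaled_exponential_sum)
      (simp_all add: normalised_tetranacci_expansion_def tetra_gf1_def)
  then show ?thesis
    unfolding sum_1_to_4 .
qed

text \<open>The series \<open>g\<close> is the exponential sum of the sequence \<open>V\<close> at \<open>-x\<close>. Multiplying it by \<open>e^x\<close>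
  replaces \<open>-\<lambda>\<^sub>i\<close> by \<open>1 - \<lambda>\<^sub>i\<close>, the sum of the other three roots, and so gives the third
  elementary symmetric polynomial of the waves.\<close>

lemma egf_V:
  assumes roots: "enumerates_tetra_roots lam"
    and V: "normalised_tetranacci_expansion (tetra_gf2 lam n) B v"
  defines "w \<equiv> tetra_wave lam n"
  obtains g where "egf (\<lambda>k. (- 1) ^ k * of_int (v k)) = fps_const (of_rat B) * g"
    and "g * fps_exp 1 = w 1 * w 2 * w 3 + w 1 * w 2 * w 4 + w 1 * w 3 * w 4 + w 2 * w 3 * w 4"
proof -
  let ?c = "\<lambda>i. tetra_coeff (lam i) ^ n"
  have diffs: "{1..4} - {1} = {2,3,4::nat}" "{1..4} - {2} = {1,3,4::nat}"
    "{1..4} - {3} = {1,2,4::nat}" "{1..4} - {4} = {1,2,3::nat}"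
    by auto
  have s: "lam 1 + lam 2 + lam 3 + lam 4 = 1"
    using tetra_roots_vieta(1)[OF roots] .
  have exps: "lam 2 + lam 3 + lam 4 = 1 + - lam 1" "lam 1 + lam 3 + lam 4 = 1 + - lam 2"
    "lam 1 + lam 2 + lam 4 = 1 + - lam 3" "lam 1 + lam 2 + lam 3 = 1 + - lam 4"
    by (simp_all flip: s)
  have triple: "w i * w j * w l = fps_const (?c i * ?c j * ?c l) * fps_exp (lam i + lam j + lam l)"
    for i j l
    by (simp add: w_def tetra_wave_def fps_exp_add_mult mult_ac flip: fps_const_mult)
  let ?g = "\<Sum>i=1..4. fps_const (\<Prod>j\<in>{1..4}-{i}. ?c j) * fps_exp (- 1 * lam i)"
  have "egf (\<lambda>k. (- 1) ^ k * of_int (v k)) = fps_const (of_rat B) * ?g"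
    using V by (intro egf_scaled_exponential_sum)
      (simp_all add: normalised_tetranacci_expansion_def tetra_gf2_def)
  moreover have "?g * fps_exp 1 = w 1 * w 2 * w 3 + w 1 * w 2 * w 4 + w 1 * w 3 * w 4 + w 2 * w 3 * w 4"
    unfolding triple exps sum_1_to_4 diffs fps_exp_add_mult
    by (simp add: algebra_simps)
  ultimately show ?thesis
    by (rule that)
qed

lemma prod_tetra_wave:
  fixes lam n
  assumes "enumerates_tetra_roots lam"
  defines "w \<equiv> tetra_wave lam n"
  shows "w 1 * w 2 * w 3 * w 4 = fps_const ((- 1 / 563) ^ n) * fps_exp 1"
proof -
  have "w 1 * w 2 * w 3 * w 4 =
      fps_const ((tetra_coeff (lam 1) * tetra_coeff (lam 2) * tetra_coeff (lam 3) * tetra_coeff (lam 4)) ^ n)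
      * fps_exp (lam 1 + lam 2 + lam 3 + lam 4)"
    by (simp add: w_def tetra_wave_def fps_exp_add_mult power_mult_distrib mult_ac flip: fps_const_mult)
  then show ?thesis
    unfolding prod_tetra_coeff[OF assms(1)] tetra_roots_vieta(1)[OF assms(1)] .
qed

text \<open>The definition of \<open>t\<^sub>1\<close> is the coefficientwise form of \<open>e\<^sub>2 = (p\<^sub>1^2 - p\<^sub>2) / 2\<close>.\<close>

lemma egf_t1:
  assumes U1: "normalised_tetranacci_expansion (tetra_gf1 lam n) (A1 n) (U n)"
    and U2: "normalised_tetranacci_expansion (tetra_gf1 lam (2 * n)) (A1 (2 * n)) (U (2 * n))"
  defines "w \<equiv> tetra_wave lam n"
  shows "egf (tetra_t1 A1 U n) = w 1 * w 2 + w 1 * w 3 + w 1 * w 4 + w 2 * w 3 + w 2 * w 4 + w 3 * w 4"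
    (is "_ = ?e2")
proof -
  let ?p1 = "w 1 + w 2 + w 3 + w 4" and ?p2 = "w 1 ^ 2 + w 2 ^ 2 + w 3 ^ 2 + w 4 ^ 2"
  have nz: "of_rat (A1 n) \<noteq> (0::complex)" "of_rat (A1 (2 * n)) \<noteq> (0::complex)"
    using U1 U2 by (simp_all add: normalised_tetranacci_expansion_def)
  have g1: "egf (\<lambda>k. of_int (U n k)) = fps_const (of_rat (A1 n)) * ?p1"
    using egf_U[of lam 1 n "A1 n" "U n"] U1 by (simp add: w_def)
  have g2: "egf (\<lambda>k. 2 ^ k * of_int (U (2 * n) k)) = fps_const (of_rat (A1 (2 * n))) * ?p2"
    using egf_U[of lam 2 n, OF U2] by (simp add: w_def)
  show ?thesis
  proof (rule fps_ext)
    fix m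
    have "(\<Sum>k=0..m. of_nat (m choose k) * of_int (U n k) * of_int (U n (m - k)))
        = fact m * (of_rat (A1 n) ^ 2 * fps_nth (?p1 * ?p1) m)"
      using binomial_convolution[OF g1 g1, of m] by (simp add: power2_eq_square mult.assoc)
    moreover have "2 ^ m * of_int (U (2 * n) m) = fact m * (of_rat (A1 (2 * n)) * fps_nth ?p2 m)"
      using arg_cong[OF g2, of "\<lambda>f. fps_nth f m"] by (simp add: egf_nth field_simps)
    ultimately have "tetra_t1 A1 U n m = fact m * (1 / 2 * fps_nth (?p1 * ?p1 - ?p2) m)"
      unfolding tetra_t1_def using nz by (simp add: field_simps)
    also have "?p1 * ?p1 - ?p2 = fps_const 2 * ?e2"
      unfolding numeral_fps_const[symmetric] by algebra
    also have "1 / 2 * fps_nth (fps_const 2 * ?e2) m = fps_nth ?e2 m"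
      by (simp only: fps_mult_left_const_nth) simp
    finally show "fps_nth (egf (tetra_t1 A1 U n)) m = fps_nth ?e2 m"
      by (simp only: egf_nth) simp
  qed
qed

lemma egf_t2:
  fixes lam n
  defines "w \<equiv> tetra_wave lam n"
  shows "egf (tetra_t2 lam n) = w 1 * w 2 * w 3 * (w 1 + w 2 + w 3) + w 1 * w 2 * w 4 * (w 1 + w 2 + w 4)
     + w 1 * w 3 * w 4 * (w 1 + w 3 + w 4) + w 2 * w 3 * w 4 * (w 2 + w 3 + w 4)"
proof -
  have triples: "{(i, j, l). 1 \<le> i \<and> i < j \<and> j < l \<and> l \<le> (4::nat)} = {(1,2,3), (1,2,4), (1,3,4), (2,3,4)}"
    by auto
  show ?thesis
    unfolding tetra_t2_def egf_fact_mult_nth triples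
    by (simp add: w_def tetra_wave_def fps_exp_add_mult mult_ac flip: fps_const_mult)
qed

theorem theorem16:
  fixes lam :: "nat \<Rightarrow> complex"
    and A1 A2 :: "nat \<Rightarrow> rat" and U V :: "nat \<Rightarrow> nat \<Rightarrow> int"
    and G I L M N P Q R S A E F H J K :: complex
    and m n :: nat
  assumes roots: "enumerates_tetra_roots lam"
    and U: "\<And>r. r \<ge> 1 \<Longrightarrow> normalised_tetranacci_expansion (tetra_gf1 lam r) (A1 r) (U r)"
    and V: "\<And>r. r \<ge> 1 \<Longrightarrow> normalised_tetranacci_expansion (tetra_gf2 lam r) (A2 r) (V r)"
    and A: "A = I + 2 * L + 2 * N + P + 2 * Q + 6 * R + 4 * S - 14"
    and E: "E = - I - 2 * L - N - Q - 3 * R - S + 5"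
    and F: "F = 4 * G + I + 2 * L + 6 * N + 5 * P + 6 * Q + 18 * R + 16 * S - 50"
    and H: "H = - L - 2 * N - P - Q - 4 * R - 3 * S + 10"
    and J: "J = - G - I - 2 * L - M - 2 * P - 3 * Q - 6 * R - 7 * S + 20"
    and K: "K = - 2 * G - 2 * M - 2 * N - 5 * P - 2 * Q - 6 * R - 12 * S + 30"
    and n: "n \<ge> 1"
  shows
    "1 / of_rat (A1 n) ^ 5
        * (\<Sum>(k1, k2, k3, k4, k5)\<in>{(k1, k2, k3, k4, k5). k1 + k2 + k3 + k4 + k5 = m}.
            multinom [k1, k2, k3, k4, k5] * of_int (U n k1) * of_int (U n k2) * of_int (U n k3) * of_int (U n k4) * of_int (U n k5))
     = A / of_rat (A1 (5 * n)) * 5 ^ m * of_int (U (5 * n) m)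
      + E / (of_rat (A1 (4 * n)) * of_rat (A1 n))
        * (\<Sum>k=0..m. of_nat (m choose k) * 4 ^ (m - k) * of_int (U (4 * n) (m - k)) * of_int (U n k))
      + F / of_rat (A1 n) * (- 1 / 563) ^ n * (\<Sum>k=0..m. of_nat (m choose k) * of_int (U n k))
      + G / of_rat (A1 n)
        * (\<Sum>k=0..m. of_nat (m choose k) * tetra_t2 lam n k * of_int (U n (m - k)))
      + H / (of_rat (A1 (3 * n)) * of_rat (A1 (2 * n)))
        * (\<Sum>k=0..m. of_nat (m choose k) * 3 ^ (m - k) * 2 ^ k * of_int (U (3 * n) (m - k)) * of_int (U (2 * n) k))
      + I / of_rat (A1 (3 * n))
        * (\<Sum>k=0..m. of_nat (m choose k) * 3 ^ k * of_int (U (3 * n) k) * tetra_t1 A1 U n (m - k))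
      + J / (of_rat (A2 n) * of_rat (A1 (2 * n)))
        * (\<Sum>(k1, k2, k3)\<in>{(k1, k2, k3). k1 + k2 + k3 = m}.
            multinom [k1, k2, k3] * (- 1) ^ k1 * of_int (V n k1) * 2 ^ k2 * of_int (U (2 * n) k2))
      + K / of_rat (A2 n)
        * (\<Sum>(k1, k2, k3)\<in>{(k1, k2, k3). k1 + k2 + k3 = m}.
            multinom [k1, k2, k3] * (- 1) ^ k1 * of_int (V n k1) * tetra_t1 A1 U n k2)
      + L / (of_rat (A1 (3 * n)) * of_rat (A1 n) ^ 2)
        * (\<Sum>(k1, k2, k3)\<in>{(k1, k2, k3). k1 + k2 + k3 = m}.
            multinom [k1, k2, k3] * 3 ^ k1 * of_int (U (3 * n) k1) * of_int (U n k2) * of_int (U n k3))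
      + M / (of_rat (A2 n) * of_rat (A1 n) ^ 2)
        * (\<Sum>(k1, k2, k3, k4)\<in>{(k1, k2, k3, k4). k1 + k2 + k3 + k4 = m}.
            multinom [k1, k2, k3, k4] * (- 1) ^ k1 * of_int (V n k1) * of_int (U n k2) * of_int (U n k3))
      + N / (of_rat (A1 (2 * n)) ^ 2 * of_rat (A1 n))
        * (\<Sum>(k1, k2, k3)\<in>{(k1, k2, k3). k1 + k2 + k3 = m}.
            multinom [k1, k2, k3] * 2 ^ k1 * of_int (U (2 * n) k1) * 2 ^ k2 * of_int (U (2 * n) k2) * of_int (U n k3))
      + P / of_rat (A1 n)
        * (\<Sum>(k1, k2, k3)\<in>{(k1, k2, k3). k1 + k2 + k3 = m}.
            multinom [k1, k2, k3] * tetra_t1 A1 U n k1 * tetra_t1 A1 U n k2 * of_int (U n k3))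
      + Q / (of_rat (A1 (2 * n)) * of_rat (A1 n))
        * (\<Sum>(k1, k2, k3)\<in>{(k1, k2, k3). k1 + k2 + k3 = m}.
            multinom [k1, k2, k3] * 2 ^ k1 * of_int (U (2 * n) k1) * tetra_t1 A1 U n k2 * of_int (U n k3))
      + R / (of_rat (A1 (2 * n)) * of_rat (A1 n) ^ 3)
        * (\<Sum>(k1, k2, k3, k4)\<in>{(k1, k2, k3, k4). k1 + k2 + k3 + k4 = m}.
            multinom [k1, k2, k3, k4] * 2 ^ k1 * of_int (U (2 * n) k1) * of_int (U n k2) * of_int (U n k3) * of_int (U n k4))
      + S / of_rat (A1 n) ^ 3
        * (\<Sum>(k1, k2, k3, k4)\<in>{(k1, k2, k3, k4). k1 + k2 + k3 + k4 = m}.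
            multinom [k1, k2, k3, k4] * tetra_t1 A1 U n k1 * of_int (U n k2) * of_int (U n k3) * of_int (U n k4))"
proof -
  define w where "w = tetra_wave lam n"
  define e1 where "e1 = w 1 + w 2 + w 3 + w 4"
  define e2 where "e2 = w 1 * w 2 + w 1 * w 3 + w 1 * w 4 + w 2 * w 3 + w 2 * w 4 + w 3 * w 4"
  define e3 where "e3 = w 1 * w 2 * w 3 + w 1 * w 2 * w 4 + w 1 * w 3 * w 4 + w 2 * w 3 * w 4"
  define e4 where "e4 = w 1 * w 2 * w 3 * w 4"
  define p2 where "p2 = w 1 ^ 2 + w 2 ^ 2 + w 3 ^ 2 + w 4 ^ 2"
  define p3 where "p3 = w 1 ^ 3 + w 2 ^ 3 + w 3 ^ 3 + w 4 ^ 3"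
  define p4 where "p4 = w 1 ^ 4 + w 2 ^ 4 + w 3 ^ 4 + w 4 ^ 4"
  define p5 where "p5 = w 1 ^ 5 + w 2 ^ 5 + w 3 ^ 5 + w 4 ^ 5"
  define t2 where "t2 = w 1 * w 2 * w 3 * (w 1 + w 2 + w 3) + w 1 * w 2 * w 4 * (w 1 + w 2 + w 4)
    + w 1 * w 3 * w 4 * (w 1 + w 3 + w 4) + w 2 * w 3 * w 4 * (w 2 + w 3 + w 4)"
  let ?a1 = "of_rat (A1 n) :: complex" and ?a2 = "of_rat (A1 (2 * n)) :: complex"
    and ?a3 = "of_rat (A1 (3 * n)) :: complex" and ?a4 = "of_rat (A1 (4 * n)) :: complex"
    and ?a5 = "of_rat (A1 (5 * n)) :: complex" and ?b = "of_rat (A2 n) :: complex"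
  have nz: "?a1 \<noteq> 0" "?a2 \<noteq> 0" "?a3 \<noteq> 0" "?a4 \<noteq> 0" "?a5 \<noteq> 0" "?b \<noteq> 0"
    using U[of n] U[of "2 * n"] U[of "3 * n"] U[of "4 * n"] U[of "5 * n"] V[of n] n
    by (simp_all add: normalised_tetranacci_expansion_def)
  have gp: "egf (\<lambda>k. of_nat j ^ k * of_int (U (j * n) k))
      = fps_const (of_rat (A1 (j * n))) * (w 1 ^ j + w 2 ^ j + w 3 ^ j + w 4 ^ j)" if "j \<ge> 1" for j
    using egf_U[OF U, of j n] that n by (simp add: w_def)
  have g1: "egf (\<lambda>k. of_int (U n k)) = fps_const ?a1 * e1"
    using gp[of 1] by (simp add: e1_def)
  have g2: "egf (\<lambda>k. 2 ^ k * of_int (U (2 * n) k)) = fps_const ?a2 * p2"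
    using gp[of 2] by (simp add: p2_def)
  have g3: "egf (\<lambda>k. 3 ^ k * of_int (U (3 * n) k)) = fps_const ?a3 * p3"
    using gp[of 3] by (simp add: p3_def)
  have g4: "egf (\<lambda>k. 4 ^ k * of_int (U (4 * n) k)) = fps_const ?a4 * p4"
    using gp[of 4] by (simp add: p4_def)
  have g5: "egf (\<lambda>k. 5 ^ k * of_int (U (5 * n) k)) = fps_const ?a5 * p5"
    using gp[of 5] by (simp add: p5_def)
  have gt1: "egf (tetra_t1 A1 U n) = fps_const 1 * e2"
    using egf_t1[OF U U, of n] n by (simp add: e2_def w_def)
  have gt2: "egf (tetra_t2 lam n) = fps_const 1 * t2"
    using egf_t2[of lam n] by (simp add: t2_def w_def)
  \<comment> \<open>The constant sequence fills the summation index that carries no factor.\<close>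
  have g0: "egf (\<lambda>_. 1) = fps_const 1 * fps_exp 1"
    by (simp add: egf_one)
  obtain v where gV: "egf (\<lambda>k. (- 1) ^ k * of_int (V n k)) = fps_const ?b * v"
    and v: "v * fps_exp 1 = e3"
    using egf_V[OF roots V[OF n]] by (metis e3_def w_def)
  have e4: "e4 = fps_const ((- 1 / 563) ^ n) * fps_exp 1"
    using prod_tetra_wave[OF roots, of n] by (simp add: e4_def w_def)

  \<comment> \<open>Each term of the claim is a coefficient of one summand of the polynomial identity. The
    factors \<open>e3\<close> and \<open>e4\<close> absorb the series \<open>fps_exp 1\<close>.\<close>
  have T0: "1 / of_rat (A1 n) ^ 5
        * (\<Sum>(k1, k2, k3, k4, k5)\<in>{(k1, k2, k3, k4, k5). k1 + k2 + k3 + k4 + k5 = m}.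
            multinom [k1, k2, k3, k4, k5] * of_int (U n k1) * of_int (U n k2) * of_int (U n k3) * of_int (U n k4) * of_int (U n k5))
    = fact m * fps_nth (e1 ^ 5) m"
    (is "_ * ?X = _")
  proof -
    have "?X = fact m * (?a1 * ?a1 * ?a1 * ?a1 * ?a1 * fps_nth (e1 * (e1 * (e1 * (e1 * e1)))) m)"
      using multinomial_convolution5[OF g1 g1 g1 g1 g1, of m] by (simp only: mult.assoc)
    then show ?thesis
      using nz by (simp add: power_numeral_reduce field_simps)
  qed
  have TA: "A / of_rat (A1 (5 * n)) * 5 ^ m * of_int (U (5 * n) m)
    = fact m * fps_nth (fps_const A * p5) m"
    using arg_cong[OF g5, of "\<lambda>f. fps_nth f m"] nz by (simp add: egf_nth field_simps)
  have TE: "E / (of_rat (A1 (4 * n)) * of_rat (A1 n))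
        * (\<Sum>k=0..m. of_nat (m choose k) * 4 ^ (m - k) * of_int (U (4 * n) (m - k)) * of_int (U n k))
    = fact m * fps_nth (fps_const E * (p4 * e1)) m"
    (is "_ * ?X = _")
  proof -
    have "?X = fact m * (?a1 * ?a4 * fps_nth (e1 * p4) m)"
      using binomial_convolution[OF g1 g4, of m] by (simp only: mult_ac mult_1_left mult_1_right)
    moreover have "e1 * p4 = p4 * e1"
      by (simp add: mult_ac)
    ultimately show ?thesis
      using nz by (simp add: power2_eq_square power3_eq_cube)
  qed
  have TF: "F / of_rat (A1 n) * (- 1 / 563) ^ n * (\<Sum>k=0..m. of_nat (m choose k) * of_int (U n k))
    = fact m * fps_nth (fps_const F * (e4 * e1)) m"
    (is "_ * _ * ?X = _")
  proof -
    have "?X = fact m * (?a1 * 1 * fps_nth (e1 * fps_exp 1) m)"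
      using binomial_convolution[OF g1 g0, of m] by (simp only: mult_ac mult_1_left mult_1_right)
    moreover have "fps_const F * (e4 * e1) = fps_const (F * (- 1 / 563) ^ n) * (e1 * fps_exp 1)"
      unfolding e4 fps_const_mult[symmetric] by (simp only: mult_ac)
    ultimately show ?thesis
      using nz by (simp only: fps_mult_left_const_nth) simp
  qed
  have TG: "G / of_rat (A1 n)
        * (\<Sum>k=0..m. of_nat (m choose k) * tetra_t2 lam n k * of_int (U n (m - k)))
    = fact m * fps_nth (fps_const G * (t2 * e1)) m"
    (is "_ * ?X = _")
  proof -
    have "?X = fact m * (1 * ?a1 * fps_nth (t2 * e1) m)"
      using binomial_convolution[OF gt2 g1, of m] by (simp only: mult_ac mult_1_left mult_1_right)
    then show ?thesis
      using nz by (simp add: power2_eq_square power3_eq_cube)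
  qed
  have TH: "H / (of_rat (A1 (3 * n)) * of_rat (A1 (2 * n)))
        * (\<Sum>k=0..m. of_nat (m choose k) * 3 ^ (m - k) * 2 ^ k * of_int (U (3 * n) (m - k)) * of_int (U (2 * n) k))
    = fact m * fps_nth (fps_const H * (p3 * p2)) m"
    (is "_ * ?X = _")
  proof -
    have "?X = fact m * (?a2 * ?a3 * fps_nth (p2 * p3) m)"
      using binomial_convolution[OF g2 g3, of m] by (simp only: mult_ac mult_1_left mult_1_right)
    moreover have "p2 * p3 = p3 * p2"
      by (simp add: mult_ac)
    ultimately show ?thesis
      using nz by (simp add: power2_eq_square power3_eq_cube)
  qed
  have TI: "I / of_rat (A1 (3 * n))
        * (\<Sum>k=0..m. of_nat (m choose k) * 3 ^ k * of_int (U (3 * n) k) * tetra_t1 A1 U n (m - k))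
    = fact m * fps_nth (fps_const I * (p3 * e2)) m"
    (is "_ * ?X = _")
  proof -
    have "?X = fact m * (?a3 * 1 * fps_nth (p3 * e2) m)"
      using binomial_convolution[OF g3 gt1, of m] by (simp only: mult_ac mult_1_left mult_1_right)
    then show ?thesis
      using nz by (simp add: power2_eq_square power3_eq_cube)
  qed
  have TJ: "J / (of_rat (A2 n) * of_rat (A1 (2 * n)))
        * (\<Sum>(k1, k2, k3)\<in>{(k1, k2, k3). k1 + k2 + k3 = m}.
            multinom [k1, k2, k3] * (- 1) ^ k1 * of_int (V n k1) * 2 ^ k2 * of_int (U (2 * n) k2))
    = fact m * fps_nth (fps_const J * (e3 * p2)) m"
    (is "_ * ?X = _")
  proof -
    have "?X = fact m * (?b * ?a2 * 1 * fps_nth (v * (p2 * fps_exp 1)) m)"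
      using multinomial_convolution3[OF gV g2 g0, of m] by (simp only: mult_ac mult_1_left mult_1_right)
    moreover have "v * (p2 * fps_exp 1) = e3 * p2"
      by (simp add: v[symmetric] mult_ac)
    ultimately show ?thesis
      using nz by (simp add: power2_eq_square power3_eq_cube)
  qed
  have TK: "K / of_rat (A2 n)
        * (\<Sum>(k1, k2, k3)\<in>{(k1, k2, k3). k1 + k2 + k3 = m}.
            multinom [k1, k2, k3] * (- 1) ^ k1 * of_int (V n k1) * tetra_t1 A1 U n k2)
    = fact m * fps_nth (fps_const K * (e3 * e2)) m"
    (is "_ * ?X = _")
  proof -
    have "?X = fact m * (?b * 1 * 1 * fps_nth (v * (e2 * fps_exp 1)) m)"
      using multinomial_convolution3[OF gV gt1 g0, of m] by (simp only: mult_ac mult_1_left mult_1_right)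
    moreover have "v * (e2 * fps_exp 1) = e3 * e2"
      by (simp add: v[symmetric] mult_ac)
    ultimately show ?thesis
      using nz by (simp add: power2_eq_square power3_eq_cube)
  qed
  have TL: "L / (of_rat (A1 (3 * n)) * of_rat (A1 n) ^ 2)
        * (\<Sum>(k1, k2, k3)\<in>{(k1, k2, k3). k1 + k2 + k3 = m}.
            multinom [k1, k2, k3] * 3 ^ k1 * of_int (U (3 * n) k1) * of_int (U n k2) * of_int (U n k3))
    = fact m * fps_nth (fps_const L * (p3 * (e1 * e1))) m"
    (is "_ * ?X = _")
  proof -
    have "?X = fact m * (?a3 * ?a1 * ?a1 * fps_nth (p3 * (e1 * e1)) m)"
      using multinomial_convolution3[OF g3 g1 g1, of m] by (simp only: mult_ac mult_1_left mult_1_right)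
    then show ?thesis
      using nz by (simp add: power2_eq_square power3_eq_cube)
  qed
  have TM: "M / (of_rat (A2 n) * of_rat (A1 n) ^ 2)
        * (\<Sum>(k1, k2, k3, k4)\<in>{(k1, k2, k3, k4). k1 + k2 + k3 + k4 = m}.
            multinom [k1, k2, k3, k4] * (- 1) ^ k1 * of_int (V n k1) * of_int (U n k2) * of_int (U n k3))
    = fact m * fps_nth (fps_const M * (e3 * (e1 * e1))) m"
    (is "_ * ?X = _")
  proof -
    have "?X = fact m * (?b * ?a1 * ?a1 * 1 * fps_nth (v * (e1 * (e1 * fps_exp 1))) m)"
      using multinomial_convolution4[OF gV g1 g1 g0, of m] by (simp only: mult_ac mult_1_left mult_1_right)
    moreover have "v * (e1 * (e1 * fps_exp 1)) = e3 * (e1 * e1)"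
      by (simp add: v[symmetric] mult_ac)
    ultimately show ?thesis
      using nz by (simp add: power2_eq_square power3_eq_cube)
  qed
  have TN: "N / (of_rat (A1 (2 * n)) ^ 2 * of_rat (A1 n))
        * (\<Sum>(k1, k2, k3)\<in>{(k1, k2, k3). k1 + k2 + k3 = m}.
            multinom [k1, k2, k3] * 2 ^ k1 * of_int (U (2 * n) k1) * 2 ^ k2 * of_int (U (2 * n) k2) * of_int (U n k3))
    = fact m * fps_nth (fps_const N * (p2 * (p2 * e1))) m"
    (is "_ * ?X = _")
  proof -
    have "?X = fact m * (?a2 * ?a2 * ?a1 * fps_nth (p2 * (p2 * e1)) m)"
      using multinomial_convolution3[OF g2 g2 g1, of m] by (simp only: mult_ac mult_1_left mult_1_right)
    then show ?thesis
      using nz by (simp add: power2_eq_square power3_eq_cube)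
  qed
  have TP: "P / of_rat (A1 n)
        * (\<Sum>(k1, k2, k3)\<in>{(k1, k2, k3). k1 + k2 + k3 = m}.
            multinom [k1, k2, k3] * tetra_t1 A1 U n k1 * tetra_t1 A1 U n k2 * of_int (U n k3))
    = fact m * fps_nth (fps_const P * (e2 * (e2 * e1))) m"
    (is "_ * ?X = _")
  proof -
    have "?X = fact m * (1 * 1 * ?a1 * fps_nth (e2 * (e2 * e1)) m)"
      using multinomial_convolution3[OF gt1 gt1 g1, of m] by (simp only: mult_ac mult_1_left mult_1_right)
    then show ?thesis
      using nz by (simp add: power2_eq_square power3_eq_cube)
  qed
  have TQ: "Q / (of_rat (A1 (2 * n)) * of_rat (A1 n))
        * (\<Sum>(k1, k2, k3)\<in>{(k1, k2, k3). k1 + k2 + k3 = m}.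
            multinom [k1, k2, k3] * 2 ^ k1 * of_int (U (2 * n) k1) * tetra_t1 A1 U n k2 * of_int (U n k3))
    = fact m * fps_nth (fps_const Q * (p2 * (e2 * e1))) m"
    (is "_ * ?X = _")
  proof -
    have "?X = fact m * (?a2 * 1 * ?a1 * fps_nth (p2 * (e2 * e1)) m)"
      using multinomial_convolution3[OF g2 gt1 g1, of m] by (simp only: mult_ac mult_1_left mult_1_right)
    then show ?thesis
      using nz by (simp add: power2_eq_square power3_eq_cube)
  qed
  have TR: "R / (of_rat (A1 (2 * n)) * of_rat (A1 n) ^ 3)
        * (\<Sum>(k1, k2, k3, k4)\<in>{(k1, k2, k3, k4). k1 + k2 + k3 + k4 = m}.
            multinom [k1, k2, k3, k4] * 2 ^ k1 * of_int (U (2 * n) k1) * of_int (U n k2) * of_int (U n k3) * of_int (U n k4))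
    = fact m * fps_nth (fps_const R * (p2 * (e1 * (e1 * e1)))) m"
    (is "_ * ?X = _")
  proof -
    have "?X = fact m * (?a2 * ?a1 * ?a1 * ?a1 * fps_nth (p2 * (e1 * (e1 * e1))) m)"
      using multinomial_convolution4[OF g2 g1 g1 g1, of m] by (simp only: mult_ac mult_1_left mult_1_right)
    then show ?thesis
      using nz by (simp add: power2_eq_square power3_eq_cube)
  qed
  have TS: "S / of_rat (A1 n) ^ 3
        * (\<Sum>(k1, k2, k3, k4)\<in>{(k1, k2, k3, k4). k1 + k2 + k3 + k4 = m}.
            multinom [k1, k2, k3, k4] * tetra_t1 A1 U n k1 * of_int (U n k2) * of_int (U n k3) * of_int (U n k4))
    = fact m * fps_nth (fps_const S * (e2 * (e1 * (e1 * e1)))) m"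
    (is "_ * ?X = _")
  proof -
    have "?X = fact m * (1 * ?a1 * ?a1 * ?a1 * fps_nth (e2 * (e1 * (e1 * e1))) m)"
      using multinomial_convolution4[OF gt1 g1 g1 g1, of m] by (simp only: mult_ac mult_1_left mult_1_right)
    then show ?thesis
      using nz by (simp add: power2_eq_square power3_eq_cube)
  qed

  have identity: "e1 ^ 5 = fps_const A * p5
      + fps_const E * (p4 * e1)
      + fps_const F * (e4 * e1)
      + fps_const G * (t2 * e1)
      + fps_const H * (p3 * p2)
      + fps_const I * (p3 * e2)
      + fps_const J * (e3 * p2)
      + fps_const K * (e3 * e2)
      + fps_const L * (p3 * (e1 * e1))
      + fps_const M * (e3 * (e1 * e1))
      + fps_const N * (p2 * (p2 * e1))
      + fps_const P * (e2 * (e2 * e1))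
      + fps_const Q * (p2 * (e2 * e1))
      + fps_const R * (p2 * (e1 * (e1 * e1)))
      + fps_const S * (e2 * (e1 * (e1 * e1)))"
  proof (rule power5_sum_identity[OF e1_def e2_def e3_def e4_def p2_def p3_def p4_def p5_def t2_def])
    show "fps_const A = fps_const I + 2 * fps_const L + 2 * fps_const N + fps_const P + 2 * fps_const Q + 6 * fps_const R + 4 * fps_const S - 14"
      unfolding A by (simp only: numeral_fps_const fps_const_mult fps_const_add fps_const_sub fps_const_neg)
    show "fps_const E = - fps_const I - 2 * fps_const L - fps_const N - fps_const Q - 3 * fps_const R - fps_const S + 5"
      unfolding E by (simp only: numeral_fps_const fps_const_mult fps_const_add fps_const_sub fps_const_neg)
    show "fps_const F = 4 * fps_const G + fps_const I + 2 * fps_const L + 6 * fps_const N + 5 * fps_const P + 6 * fps_const Q + 18 * fps_const R + 16 * fps_const S - 50"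
      unfolding F by (simp only: numeral_fps_const fps_const_mult fps_const_add fps_const_sub fps_const_neg)
    show "fps_const H = - fps_const L - 2 * fps_const N - fps_const P - fps_const Q - 4 * fps_const R - 3 * fps_const S + 10"
      unfolding H by (simp only: numeral_fps_const fps_const_mult fps_const_add fps_const_sub fps_const_neg)
    show "fps_const J = - fps_const G - fps_const I - 2 * fps_const L - fps_const M - 2 * fps_const P - 3 * fps_const Q - 6 * fps_const R - 7 * fps_const S + 20"
      unfolding J by (simp only: numeral_fps_const fps_const_mult fps_const_add fps_const_sub fps_const_neg)
    show "fps_const K = - 2 * fps_const G - 2 * fps_const M - 2 * fps_const N - 5 * fps_const P - 2 * fps_const Q - 6 * fps_const R - 12 * fps_const S + 30"
      unfolding K by (simp only: numeral_fps_const fps_const_mult fps_const_add fps_const_sub fps_const_neg)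
  qed
  \<comment> \<open>Comparing coefficients of \<open>x^m/m!\<close> gives the claim.\<close>
  show ?thesis
    unfolding T0 TA TE TF TG TH TI TJ TK TL TM TN TP TQ TR TS identity fps_add_nth distrib_left ..
qed

end
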